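(* Let $n>1$ be an odd integer and $a$ an indeterminate, and let $M=(n+1)/2$ or $M=n-1$. Then $$ \sum_{k=0}^{M}[4k-1]_{q^2}[4k-1]^2\frac{(q^{-2};q^4)_k^2(q^{-2}/a;q^4)_k(aq^{-2};q^4)_k} {(q^4;q^4)_k^2(q^4/a;q^4)_k(aq^4;q^4)_k}q^{4k}\equiv 0 \pmod{[n]_{q^2}^2(1-aq^{2n})(a-q^{2n})}. $$
   Context: $q$ and $a$ are indeterminates. For an integer $m$, $[m]=[m]_q=(1-q^m)/(1-q)$ and $[m]_{q^2}=(1-q^{2m})/(1-q^2)$. The $q$-shifted factorial is $(x;q)_0=1$ and $(x;q)_k=(1-x)(1-xq)\cdots(1-xq^{k-1})$ for $k\ge1$. A congruence of rational functions in $q,a$ modulo a polynomial $P$ means the difference of the two sides is a rational function whose denominator is coprime to $P$ and whose numerator is divisible by $P$ (Laurent monomials in $q$ are allowed). *)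

theory Defs
  imports "HOL-Computational_Algebra.Polynomial" "HOL-Computational_Algebra.Fraction_Field"
begin

text \<open>Polynomials in the two indeterminates q and a with rational coefficients:
  the outer polynomial variable is a, the inner one is q.  Rational functions in q, a
  form the fraction field of this ring.\<close>

type_synonym bipoly = "rat poly poly"
type_synonym ratfun = "bipoly fract"

definition Qp :: bipoly where "Qp = [:[:0, 1:]:]"
definition Ap :: bipoly where "Ap = [:0, 1:]"

definition emb :: "bipoly \<Rightarrow> ratfun" where "emb p = Fract p 1"

definition qv :: ratfun where "qv = emb Qp"
definition av :: ratfun where "av = emb Ap"

definition qint :: "ratfun \<Rightarrow> int \<Rightarrow> ratfun" where
  "qint x m = (1 - x powi m) / (1 - x)"

definition qpoch :: "ratfun \<Rightarrow> ratfun \<Rightarrow> nat \<Rightarrow> ratfun" where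
  "qpoch x b k = (\<Prod>j<k. (1 - x * b ^ j))"

definition rf_cong :: "ratfun \<Rightarrow> ratfun \<Rightarrow> bipoly \<Rightarrow> bool" where
  "rf_cong x y P \<longleftrightarrow> (\<exists>N D. D \<noteq> 0 \<and> coprime D P \<and> x - y = Fract (N * P) D)"

definition qint_sq_poly :: "nat \<Rightarrow> bipoly" where
  "qint_sq_poly n = (\<Sum>j<n. Qp ^ (2 * j))"

end

theory Submission
  imports Defs
    "HOL-Computational_Algebra.Polynomial_Factorial"
    "HOL-Computational_Algebra.Field_as_Ring"
begin

text \<open>
  The sum has a closed form for every upper limit. Up to the factor \<open>(1 - q\<^sup>2)(1 - q)\<^sup>2\<close>, the summand is
  \<open>y (1 - y\<^sup>2/q\<^sup>2)(1 - y/q)\<^sup>2 H\<^sub>k\<close> with \<open>y = q\<^sup>4\<^sup>k\<close>, where \<open>H\<^sub>k\<close> is the quotient of shifted factorials and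
  \<open>H\<^sub>k\<^sub>+\<^sub>1 / H\<^sub>k = F(y/q\<^sup>2) / F(q\<^sup>4 y)\<close> with \<open>F(y) = (1 - y)\<^sup>2 (1 - y/a)(1 - a y)\<close>. Gosper's equation
  \<open>s(q\<^sup>4 y) F(y/q\<^sup>2) - s(y) F(y) = y (1 - y\<^sup>2/q\<^sup>2)(1 - y/q)\<^sup>2\<close> has a solution \<open>s\<close> quadratic in \<open>y\<close>, whose
  denominator \<open>q (q\<^sup>4 - 1)((1 - a q\<^sup>2)(a - q\<^sup>2))\<^sup>2\<close> is coprime to the modulus.

  In the resulting closed form the factors \<open>1 - a q\<^sup>2\<^sup>n\<close> and \<open>a - q\<^sup>2\<^sup>n\<close> are visible. The factor \<open>[n]\<^sup>2\<close> in
  \<open>x = q\<^sup>2\<close> comes from the square of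
  \<open>(x; x\<^sup>2)\<^sub>M / (x\<^sup>2; x\<^sup>2)\<^sub>M\<close>, which is the central \<open>x\<close>-binomial coefficient divided by
  \<open>((1 + x) \<cdots> (1 + x\<^sup>M))\<^sup>2\<close>. For odd \<open>n\<close> the latter product is coprime to \<open>[n]\<close>, and \<open>[n]\<close> divides the
  binomial coefficient for both values of \<open>M\<close>.
\<close>

section \<open>Solution of Gosper's equation for the summand\<close>

text \<open>The solution \<open>s(y)\<close> of Gosper's equation with its denominator cleared.\<close>
definition gosper_cert :: "'a::comm_ring_1 \<Rightarrow> 'a \<Rightarrow> 'a \<Rightarrow> 'a" where
  "gosper_cert q a y =
    (let E = (1 - a * q^2) * (a - q^2); A = q * (1 + a)^2 - 2 * a * (q^2 + 1)
     in (q^2 + 1) * a * A * (q^6 + y^2) + q * (E^2 - q^3 * (1 + a)^2 * A) * y)"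

text \<open>The \<open>F\<close> of the overview: at y = q^(4k) with k > 0 it collects the factors
  that the denominator gains in step k.\<close>

definition wp_factor :: "'a::field \<Rightarrow> 'a \<Rightarrow> 'a" where
  "wp_factor a y = (1 - y)^2 * (1 - y / a) * (1 - a * y)"

text \<open>Multiplying by \<open>a\<close> and putting y = q^2 z turns both sides into polynomials,
  so the equation becomes an identity in a commutative ring.\<close>

lemma gosper_equation:
  fixes q a y :: "'a::field"
  assumes "q \<noteq> 0" "a \<noteq> 0"
  shows "gosper_cert q a (q^4 * y) * wp_factor a (y / q^2) - gosper_cert q a y * wp_factor a y
    = q * (q^4 - 1) * ((1 - a * q^2) * (a - q^2))^2 * (y * (1 - y^2 / q^2) * (1 - y / q)^2)"
proof -
  define z where "z = y / q^2"
  have y: "y = z * q^2" using assms(1) by (simp add: z_def)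
  have "a * (gosper_cert q a (q^4 * y) * wp_factor a z - gosper_cert q a y * wp_factor a y)
    = gosper_cert q a (q^4 * y) * ((1-z)^2 * (a - z) * (1 - a*z))
      - gosper_cert q a y * ((1-y)^2 * (a - y) * (1 - a*y))"
    using assms(2) by (simp add: wp_factor_def field_simps)
  also have "\<dots> = a * (q * (q^4 - 1) * ((1 - a * q^2) * (a - q^2))^2 * (y * (1 - z^2 * q^2) * (1 - z * q)^2))"
    unfolding gosper_cert_def Let_def y by algebra
  finally show ?thesis using assms(1,2)
    by (simp add: y power2_eq_square)
qed

section \<open>Rational functions with denominator coprime to the modulus\<close>

lemma emb_eq_to_fract: "emb = to_fract"
  by (simp add: emb_def to_fract_def fun_eq_iff)

lemma Fract_eq_emb_divide: "D \<noteq> 0 \<Longrightarrow> Fract N D = emb N / emb D"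
  by (simp add: emb_eq_to_fract Fract_conv_to_fract)

lemma emb_0 [simp]: "emb 0 = 0"
  and emb_1 [simp]: "emb 1 = 1"
  and emb_add: "emb (x + y) = emb x + emb y"
  and emb_diff: "emb (x - y) = emb x - emb y"
  and emb_mult: "emb (x * y) = emb x * emb y"
  by (simp_all add: emb_eq_to_fract)

lemma emb_eq_0_iff [simp]: "emb x = 0 \<longleftrightarrow> x = 0"
  by (simp add: emb_eq_to_fract)

lemma emb_power: "emb (x ^ k) = emb x ^ k"
  by (induction k) (simp_all add: emb_mult)

lemma emb_prod: "emb (\<Prod>i\<in>A. f i) = (\<Prod>i\<in>A. emb (f i))"
  by (induction A rule: infinite_finite_induct) (simp_all add: emb_mult)

text \<open>The localization of the polynomial ring at the elements coprime to \<open>P\<close>. A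
  rational function is congruent to 0 exactly if it is \<open>emb P\<close> times a member of this
  subring, which reduces the theorem to membership statements.\<close>

definition localized :: "bipoly \<Rightarrow> ratfun set" where
  "localized P = {emb N / emb D | N D. D \<noteq> 0 \<and> coprime D P}"

lemma localized_emb [simp]: "emb x \<in> localized P"
proof -
  have "emb x = emb x / emb 1 \<and> (1::bipoly) \<noteq> 0 \<and> coprime 1 P" by simp
  then show ?thesis unfolding localized_def by blast
qed

lemma localized_inverse_emb:
  assumes "coprime D P" "D \<noteq> 0"
  shows "inverse (emb D) \<in> localized P"
proof -
  have "inverse (emb D) = emb 1 / emb D \<and> D \<noteq> 0 \<and> coprime D P"
    using assms by (simp add: field_simps)
  then show ?thesis unfolding localized_def by blast
qed

lemma localized_mult:
  assumes "x \<in> localized P" "y \<in> localized P"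
  shows "x * y \<in> localized P"
proof -
  obtain N D N' D' where "x = emb N / emb D" "y = emb N' / emb D'"
    "D \<noteq> 0" "D' \<noteq> 0" "coprime D P" "coprime D' P"
    using assms by (auto simp: localized_def)
  then have "x * y = emb (N * N') / emb (D * D')" "D * D' \<noteq> 0" "coprime (D * D') P"
    by (simp_all add: emb_mult)
  then show ?thesis unfolding localized_def by blast
qed

lemma localized_power: "x \<in> localized P \<Longrightarrow> x ^ k \<in> localized P"
  using localized_emb[of 1 P] by (induction k) (simp_all add: localized_mult)

lemma localized_prod:
  "(\<And>i. i \<in> A \<Longrightarrow> f i \<in> localized P) \<Longrightarrow> (\<Prod>i\<in>A. f i) \<in> localized P"
  using localized_emb[of 1 P]
  by (induction A rule: infinite_finite_induct) (simp_all add: localized_mult)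

lemma rf_cong_0I:
  assumes "x \<in> localized P"
  shows "rf_cong (emb P * x) 0 P"
proof -
  obtain N D where "x = emb N / emb D" "D \<noteq> 0" "coprime D P"
    using assms by (auto simp: localized_def)
  then have "emb P * x - 0 = Fract (N * P) D"
    by (simp add: Fract_eq_emb_divide emb_mult)
  with \<open>D \<noteq> 0\<close> \<open>coprime D P\<close> show ?thesis unfolding rf_cong_def by blast
qed

section \<open>Coprimality of polynomials in q and polynomials linear in a\<close>

lemma Qp_power: "Qp ^ m = [:monom 1 m:]"
proof -
  have "[:[:0, 1::rat:]:] ^ m = [:[:0, 1:] ^ m:]"
    by (induction m) (simp_all add: one_pCons)
  then show ?thesis by (simp add: Qp_def monom_altdef)
qed

lemma Qp_power_eq_iff: "Qp ^ i = Qp ^ j \<longleftrightarrow> i = j"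
  by (auto simp: Qp_power monom_eq_iff')

lemma one_minus_Qp_power_neq_0: "m > 0 \<Longrightarrow> 1 - Qp ^ m \<noteq> 0"
  using Qp_power_eq_iff[of 0 m] by auto

lemma one_plus_Qp_power_neq_0: "1 + Qp ^ m \<noteq> 0"
proof
  assume "1 + Qp ^ m = 0"
  \<comment> \<open>At a = 0 and q = 1 the polynomial takes the value 2.\<close>
  then have "poly (poly (1 + Qp ^ m) 0) 1 = 0" by simp
  then show False by (simp add: Qp_power poly_monom)
qed

lemma one_minus_Ap_Qp: "1 - Ap * Qp ^ m = [:1, - monom 1 m:]"
  by (simp add: Ap_def Qp_power one_pCons)

lemma Ap_minus_Qp: "Ap - Qp ^ m = [:- monom 1 m, 1:]"
  by (simp add: Ap_def Qp_power)

text \<open>A common divisor has degree 0 in the outer variable a, so it divides every coefficient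
  of \<open>p\<close>, one of which is 1. The free index \<open>i\<close> serves both 1 - a q^m
  (index 0) and a - q^m (index 1).\<close>

lemma coprime_const_monicI:
  assumes "f \<noteq> (0::rat poly)" "coeff p i = 1"
  shows "coprime [:f:] p"
proof (rule coprimeI)
  fix c assume c: "c dvd [:f:]" "c dvd p"
  have "degree c = 0"
    using dvd_imp_degree_le[OF c(1)] assms(1) by simp
  then obtain c0 where c0: "c = [:c0:]" by (metis degree_eq_zeroE)
  then have "c0 dvd coeff p i" using c(2) by (simp add: const_poly_dvd_iff)
  then show "is_unit c" using c0 assms(2) by (metis const_poly_dvd_const_poly_iff one_pCons)
qed

text \<open>Eliminating a suffices: a common divisor then divides a nonzero polynomial in q alone,
  and \<open>coprime_const_monicI\<close> applies.\<close>

lemma coprime_if_combination: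
  assumes "f \<noteq> (0::rat poly)" "u * x + v * y = [:f:]" "coeff y i = 1"
  shows "coprime x y"
proof (rule coprimeI)
  fix c assume "c dvd x" "c dvd y"
  then have "c dvd [:f:]" using assms(2) by (metis dvd_add dvd_mult)
  then show "is_unit c"
    using \<open>c dvd y\<close> coprime_const_monicI[OF assms(1,3)] by (metis coprime_def)
qed

text \<open>Eliminating a leaves q^j - q^i in the first two cases and 1 - q^(i+j) in the third; the
  conditions on the exponents make these nonzero. The fourth case is the third with the roles
  exchanged.\<close>

lemma coprime_Ap_linear:
  shows "i \<noteq> j \<Longrightarrow> coprime (1 - Ap * Qp ^ i) (1 - Ap * Qp ^ j)"
    and "i \<noteq> j \<Longrightarrow> coprime (Ap - Qp ^ i) (Ap - Qp ^ j)"
    and "i + j > 0 \<Longrightarrow> coprime (1 - Ap * Qp ^ i) (Ap - Qp ^ j)"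
    and "i + j > 0 \<Longrightarrow> coprime (Ap - Qp ^ i) (1 - Ap * Qp ^ j)"
proof -
  have C: "Qp ^ i - Qp ^ j = [:monom 1 i - monom 1 j:]" "1 - Qp ^ i = [:1 - monom 1 i:]" for i j
    by (simp_all add: Qp_power one_pCons)
  have ne: "monom 1 i - monom (1::rat) j \<noteq> 0" if "i \<noteq> j" for i j
    using that by (simp add: monom_eq_iff')
  show "coprime (1 - Ap * Qp ^ i) (1 - Ap * Qp ^ j)" if "i \<noteq> j"
    by (rule coprime_if_combination[of "monom 1 j - monom 1 i" "Qp ^ j" _ "- (Qp ^ i)" _ 0])
      (use that ne in simp, simp only: C(1)[symmetric], simp add: algebra_simps, simp add: one_minus_Ap_Qp)
  show "coprime (Ap - Qp ^ i) (Ap - Qp ^ j)" if "i \<noteq> j"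
    by (rule coprime_if_combination[of "monom 1 j - monom 1 i" 1 _ "- 1" _ 1])
      (use that ne in simp, simp only: C(1)[symmetric], simp, simp add: Ap_minus_Qp)
  have *: "coprime (1 - Ap * Qp ^ i) (Ap - Qp ^ j)" if "i + j > 0" for i j
    by (rule coprime_if_combination[of "monom 1 0 - monom 1 (i + j)" 1 _ "Qp ^ i" _ 1])
      (use that ne[of 0 "i + j"] in simp, simp only: C(1)[symmetric],
        simp add: algebra_simps power_add, simp add: Ap_minus_Qp)
  then show "i + j > 0 \<Longrightarrow> coprime (1 - Ap * Qp ^ i) (Ap - Qp ^ j)" .
  show "coprime (Ap - Qp ^ i) (1 - Ap * Qp ^ j)" if "i + j > 0"
    using *[of j i] that by (simp add: coprime_commute add.commute)
qed

section \<open>Gaussian binomial coefficients and their divisibility by [n]\<close>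

text \<open>The shifted factorial (x;x)_n, not normalised by powers of 1 - x.\<close>

definition qfactorial :: "'a::comm_ring_1 \<Rightarrow> nat \<Rightarrow> 'a" where
  "qfactorial x n = (\<Prod>j<n. 1 - x ^ Suc j)"

lemma qfactorial_0 [simp]: "qfactorial x 0 = 1"
  and qfactorial_Suc: "qfactorial x (Suc n) = qfactorial x n * (1 - x ^ Suc n)"
  by (simp_all add: qfactorial_def)

text \<open>Integrality of Gaussian binomials, by the q-Pascal rule 1 - x^(i+k) = (1 - x^i) + x^i (1
  - x^k).\<close>

lemma qfactorial_mult_dvd: "qfactorial x i * qfactorial x k dvd qfactorial x (i + k)"
proof (induction "i + k" arbitrary: i k)
  case 0
  then show ?case by simp
next
  case (Suc m)
  show ?case
  proof (cases "i = 0 \<or> k = 0")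
    case True
    then show ?thesis by auto
  next
    case False
    then obtain i' k' where ik: "i = Suc i'" "k = Suc k'" by (metis not0_implies_Suc)
    have "qfactorial x i' * qfactorial x k dvd qfactorial x m"
      using Suc(1)[of i' k] Suc(2) ik by simp
    then have 1: "qfactorial x i * qfactorial x k dvd qfactorial x m * (1 - x ^ i)"
      using mult_dvd_mono[OF _ dvd_refl, of "qfactorial x i' * qfactorial x k" _ "1 - x ^ i"]
      by (simp add: ik(1) qfactorial_Suc mult_ac)
    have "qfactorial x i * qfactorial x k' dvd qfactorial x m"
      using Suc(1)[of i k'] Suc(2) ik by simp
    then have 2: "qfactorial x i * qfactorial x k dvd qfactorial x m * (1 - x ^ k)"
      using mult_dvd_mono[OF _ dvd_refl, of "qfactorial x i * qfactorial x k'" _ "1 - x ^ k"]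
      by (simp add: ik(2) qfactorial_Suc mult_ac)
    have "qfactorial x (i + k) = qfactorial x m * (1 - x ^ (i + k))"
      using Suc(2) qfactorial_Suc[of x m] by simp
    then have "qfactorial x (i + k) = qfactorial x m * (1 - x ^ i) + x ^ i * (qfactorial x m * (1 - x ^ k))"
      by (simp add: algebra_simps power_add)
    with 1 2 show ?thesis by (simp add: dvd_mult)
  qed
qed

lemma geometric_sum_Suc:
  fixes x :: "'a::comm_ring_1"
  shows "(\<Sum>j<Suc n. x ^ j) = 1 + x * (\<Sum>j<n. x ^ j)"
  by (simp add: sum.lessThan_Suc_shift sum_distrib_left del: sum.lessThan_Suc)

lemma coprime_geometric_sum_power:
  fixes x :: "'a::{idom, ring_gcd}"
  assumes "n > 0"
  shows "coprime (x ^ k) (\<Sum>j<n. x ^ j)"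
proof -
  obtain m where n: "n = Suc m" using assms gr0_implies_Suc by blast
  have "coprime x (\<Sum>j<n. x ^ j)"
    unfolding n geometric_sum_Suc by (rule coprimeI) (metis dvd_add_left_iff dvd_mult2)
  then show ?thesis by simp
qed

text \<open>Here \<open>c\<close> is the central Gaussian binomial coefficient. It suffices that [n]
  divides [i] c for some [i] coprime to [n]; in both cases i = M works.\<close>

lemma geometric_sum_dvd_central_binomial:
  fixes x c :: "'a::{idom, ring_gcd}"
  assumes n: "odd n" "n > 1" and M: "M = (n + 1) div 2 \<or> M = n - 1"
    and nz: "\<And>k. k > 0 \<Longrightarrow> x ^ k \<noteq> 1"
    and c: "qfactorial x (2 * M) = qfactorial x M ^ 2 * c"
  shows "(\<Sum>j<n. x ^ j) dvd c"
proof -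
  let ?G = "\<lambda>n. \<Sum>j<n. x ^ j"
  have nz': "qfactorial x k \<noteq> 0" for k
    using nz[of "Suc _"] by (auto simp: qfactorial_def simp del: power_Suc)
  have x1: "1 - x \<noteq> 0" using nz[of 1] by simp
  have G: "1 - x ^ k = (1 - x) * ?G k" for k by (rule one_diff_power_eq)
  have "\<exists>i e. coprime (?G i) (?G n) \<and> (1 - x ^ i) * c = (1 - x ^ n) * e"
  proof (cases "M = n - 1")
    case True
    have "n = Suc (Suc (n - 2))" using n(2) by linarith
    then obtain m where m: "n = Suc (Suc m)" by (rule that)
    \<comment> \<open>Since [n] = 1 + x [n-1], a common divisor of the two divides 1.\<close>
    have "coprime (?G (n - 1)) (?G n)"
      unfolding m diff_Suc_1 geometric_sum_Suc[of _ "Suc m"]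
      by (rule coprimeI) (metis dvd_add_left_iff dvd_mult)
    \<comment> \<open>As n + m = 2M and n = M + 1, this \<open>d\<close> is the binomial coefficient
      next to the central one; their ratio is [n]/[n-1].\<close>
    moreover obtain d where "qfactorial x (n + m) = qfactorial x n * qfactorial x m * d"
      using qfactorial_mult_dvd[of x n m] by (metis dvdE)
    then have "qfactorial x M ^ 2 * c = qfactorial x n * qfactorial x m * d"
      using c True m by (simp add: mult_2)
    then have "(qfactorial x m * qfactorial x (Suc m)) * ((1 - x ^ Suc m) * c)
      = (qfactorial x m * qfactorial x (Suc m)) * ((1 - x ^ n) * d)"
      unfolding True m by (simp add: qfactorial_Suc power2_eq_square mult_ac)
    then have "(1 - x ^ (n - 1)) * c = (1 - x ^ n) * d"
      using nz' m by simp
    ultimately show ?thesis by blast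
  next
    case False
    then have M: "2 * M = n + 1" using M n by auto
    then obtain m where m: "M = Suc m" "n = Suc (2 * m)" by (cases M) auto
    have cop: "coprime (?G M) (?G n)"
    proof (rule coprimeI)
      fix d assume d: "d dvd ?G M" "d dvd ?G n"
      \<comment> \<open>Because 2M = n + 1, [M] (1 + x^M) = [n+1] = [n] + x^n. A common divisor of
        [M] and [n] thus divides x^n, which is coprime to [n].\<close>
      have "(1 - x) * ?G (2 * M) = (1 - x) * (?G M * (1 + x ^ M))"
        unfolding mult.assoc[symmetric] G[symmetric] mult_2 power_add by (simp add: algebra_simps)
      then have "?G M * (1 + x ^ M) = ?G n + x ^ n" using x1 M by simp
      then have "d dvd x ^ n" using d by (metis dvd_add_right_iff dvd_mult2)
      then show "is_unit d" using d(2) coprime_geometric_sum_power[of n x n] n(2)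
        by (metis coprime_def gr0I not_less_zero)
    qed
    obtain d where d: "qfactorial x (m + m) = qfactorial x m * qfactorial x m * d"
      using qfactorial_mult_dvd[of x m m] by (metis dvdE)
    \<comment> \<open>With 2M = 2m + 2 = n + 1, the last two factors are 1 - x^n and 1 - x^(2M); the
      first of them supplies [n].\<close>
    have "qfactorial x (2 * M) = qfactorial x (m + m) * (1 - x ^ n) * (1 - x ^ (M + M))"
      by (simp add: m qfactorial_Suc mult_2)
    also have "1 - x ^ (M + M) = (1 - x ^ M) * (1 + x ^ M)"
      by (simp add: power_add algebra_simps)
    finally have "(qfactorial x m ^ 2 * (1 - x ^ M)) * ((1 - x ^ M) * c)
        = (qfactorial x m ^ 2 * (1 - x ^ M)) * ((1 - x ^ n) * (d * (1 + x ^ M)))"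
      unfolding c d by (simp add: m(1) qfactorial_Suc power2_eq_square mult_ac)
    then have "(1 - x ^ M) * c = (1 - x ^ n) * (d * (1 + x ^ M))"
      using nz'[of m] nz[of M] m by simp
    with cop show ?thesis by blast
  qed
  then obtain i e where *: "coprime (?G i) (?G n)" "(1 - x ^ i) * c = (1 - x ^ n) * e"
    by blast
  have "?G i * c = ?G n * e" using *(2) x1 unfolding G by simp
  then have "?G n dvd ?G i * c" by simp
  then show ?thesis using *(1) by (metis coprime_commute coprime_dvd_mult_right_iff)
qed

text \<open>The products over odd and even exponents multiply to (x;x)_(2M), and the even one is
  (x;x)_M times the product of the 1 + x^j. Their quotient is therefore the central binomial over
  the square of that product, written here without denominators.\<close>

lemma odd_even_product_quotient:
  fixes x :: "'a::{idom, ring_gcd}"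
  assumes n: "odd n" "n > 1" and M: "M = (n + 1) div 2 \<or> M = n - 1"
    and nz: "\<And>k. k > 0 \<Longrightarrow> x ^ k \<noteq> 1"
  shows "\<exists>d. (\<Prod>j<M. 1 - x ^ (2 * j + 1)) * (\<Prod>j<M. 1 + x ^ Suc j) ^ 2
    = (\<Prod>j<M. 1 - x ^ (2 * j + 2)) * ((\<Sum>j<n. x ^ j) * d)"
proof -
  let ?o = "\<Prod>j<M. 1 - x ^ (2 * j + 1)" and ?p = "\<Prod>j<M. 1 + x ^ Suc j"
    and ?e = "\<Prod>j<M. 1 - x ^ (2 * j + 2)"
  obtain c where c: "qfactorial x (2 * M) = qfactorial x M ^ 2 * c"
    using qfactorial_mult_dvd[of x M M] by (metis dvdE mult_2 power2_eq_square)
  then obtain d where d: "c = (\<Sum>j<n. x ^ j) * d"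
    using geometric_sum_dvd_central_binomial[OF n M nz] by blast
  have 1: "?o * ?e = qfactorial x (2 * M)"
    by (induction M) (simp_all add: qfactorial_Suc mult_ac)
  have 2: "?e = qfactorial x M * ?p"
    unfolding qfactorial_def prod.distrib[symmetric]
    by (rule prod.cong) (simp_all add: algebra_simps mult_2_right flip: power_add)
  have "qfactorial x M \<noteq> 0"
    using nz[of "Suc _"] by (auto simp: qfactorial_def simp del: power_Suc)
  moreover have "qfactorial x M * (?o * ?p) = qfactorial x M * (qfactorial x M * c)"
    using 1 unfolding c 2 by (simp add: power2_eq_square mult_ac)
  ultimately have "?o * ?p = qfactorial x M * c" by simp
  then have "?o * ?p ^ 2 = ?e * c" unfolding 2 by (simp add: power2_eq_square mult_ac)
  then show ?thesis unfolding d by blast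
qed

text \<open>Modulo a common divisor x^k = -1 and x^n = 1, so x^(nk) is both 1 and, \<open>n\<close>
  being odd, -1. Hence the divisor divides 2.\<close>

lemma coprime_one_plus_geometric_sum:
  fixes x :: "'a::{idom, ring_gcd}"
  assumes "odd n" "is_unit (2::'a)"
  shows "coprime (1 + x ^ k) (\<Sum>j<n. x ^ j)"
proof (rule coprimeI)
  fix d assume d: "d dvd 1 + x ^ k" "d dvd (\<Sum>j<n. x ^ j)"
  have "d dvd 1 - x ^ n" using d(2) one_diff_power_eq[of x n] by simp
  then have 1: "d dvd 1 - (x ^ n) ^ k" by (metis dvd_mult2 one_diff_power_eq)
  have "d dvd 1 - (- (x ^ k)) ^ n" using d(1) one_diff_power_eq[of "- (x ^ k)" n] by simp
  then have "d dvd 1 + (x ^ n) ^ k" using assms(1) by (simp add: mult.commute flip: power_mult)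
  then have "d dvd 2" using dvd_add[OF 1] by fastforce
  then show "is_unit d" using assms(2) dvd_trans by blast
qed

text \<open>Modulo 1 - x the geometric sum is \<open>n\<close>.\<close>

lemma coprime_one_minus_geometric_sum:
  fixes x :: "'a::{idom, ring_gcd}"
  assumes "is_unit (of_nat n :: 'a)"
  shows "coprime (1 - x) (\<Sum>j<n. x ^ j)"
proof (rule coprimeI)
  fix d assume d: "d dvd 1 - x" "d dvd (\<Sum>j<n. x ^ j)"
  have "d dvd (\<Sum>j<n. 1 - x ^ j)"
    by (intro dvd_sum) (metis d(1) dvd_mult2 one_diff_power_eq)
  then have "d dvd of_nat n - (\<Sum>j<n. x ^ j)" by (simp add: sum_subtractf)
  then have "d dvd of_nat n" using d(2) by (metis diff_add_cancel dvd_add)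
  then show "is_unit d" using assms dvd_trans by blast
qed

section \<open>Telescoping and the closed form of the sum\<close>

lemma emb_gosper_cert: "emb (gosper_cert q a y) = gosper_cert (emb q) (emb a) (emb y)"
proof -
  have "emb 2 = 2" by (metis one_add_one emb_add emb_1)
  then show ?thesis by (simp add: gosper_cert_def Let_def emb_add emb_diff emb_mult emb_power)
qed

lemma qv_neq_0 [simp]: "qv \<noteq> 0" and av_neq_0 [simp]: "av \<noteq> 0"
  by (simp_all add: qv_def av_def Qp_def Ap_def)

lemma one_minus_Ap_Qp_neq_0: "1 - Ap * Qp ^ m \<noteq> 0"
  and Ap_minus_Qp_neq_0: "Ap - Qp ^ m \<noteq> 0"
  unfolding one_minus_Ap_Qp Ap_minus_Qp by simp_all

lemma one_minus_qv_power: "1 - qv ^ m = emb (1 - Qp ^ m)"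
  and one_minus_av_qv: "1 - av * qv ^ m = emb (1 - Ap * Qp ^ m)"
  and one_minus_qv_div_av: "1 - qv ^ m / av = emb (Ap - Qp ^ m) / emb Ap"
  using av_neq_0 by (simp_all add: qv_def av_def emb_diff emb_mult emb_power field_simps)

lemma qpoch_Suc: "qpoch x b (Suc k) = qpoch x b k * (1 - x * b ^ k)"
  by (simp add: qpoch_def)

text \<open>The quotient \<open>H_k\<close> of the overview.\<close>

definition pochratio :: "nat \<Rightarrow> ratfun" where
  "pochratio k = (qpoch (inverse (qv ^ 2)) (qv ^ 4) k) ^ 2
       * qpoch (inverse (qv ^ 2) / av) (qv ^ 4) k
       * qpoch (av * inverse (qv ^ 2)) (qv ^ 4) k
       / ((qpoch (qv ^ 4) (qv ^ 4) k) ^ 2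
          * qpoch (qv ^ 4 / av) (qv ^ 4) k
          * qpoch (av * qv ^ 4) (qv ^ 4) k)"

lemma wp_factor_neq_0: "m > 0 \<Longrightarrow> wp_factor av (qv ^ m) \<noteq> 0"
  unfolding wp_factor_def one_minus_qv_power one_minus_av_qv one_minus_qv_div_av
  using one_minus_Qp_power_neq_0[of m] one_minus_Ap_Qp_neq_0[of m] Ap_minus_Qp_neq_0[of m] av_neq_0
  by (simp add: av_def)

lemma pochratio_Suc:
  "pochratio (Suc k) = pochratio k * wp_factor av (qv ^ (4 * k) / qv ^ 2) / wp_factor av (qv ^ (4 * Suc k))"
proof -
  have "qv ^ 4 * (qv ^ 4) ^ k = qv ^ (4 * Suc k)" "(qv ^ 4) ^ k = qv ^ (4 * k)"
    by (simp_all add: power_mult power_add)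
  then show ?thesis
    unfolding pochratio_def qpoch_Suc wp_factor_def
    by (simp add: power2_eq_square divide_inverse mult_ac)
qed

text \<open>Telescoping by \<open>gosper_equation\<close>; the lower boundary term vanishes because
  \<open>wp_factor av 1\<close> is 0.\<close>

lemma summand_sum:
  "(\<Sum>k<m. qv ^ (4 * k) * (1 - (qv ^ (4 * k))^2 / qv^2) * (1 - qv ^ (4 * k) / qv)^2 * pochratio k)
      * (qv * (qv^4 - 1) * ((1 - av * qv^2) * (av - qv^2))^2)
    = gosper_cert qv av (qv ^ (4 * m)) * wp_factor av (qv ^ (4 * m)) * pochratio m"
proof (induction m)
  case 0
  show ?case by (simp add: wp_factor_def)
next
  case (Suc m)
  let ?K = "qv * (qv^4 - 1) * ((1 - av * qv^2) * (av - qv^2))^2"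
  let ?y = "qv ^ (4 * m)"
  have y: "qv ^ (4 * Suc m) = qv^4 * ?y" by (simp add: power_add)
  have w: "wp_factor av (qv^4 * ?y) \<noteq> 0" using wp_factor_neq_0[of "4 * Suc m"] y by simp
  have "(\<Sum>k<Suc m. qv ^ (4 * k) * (1 - (qv ^ (4 * k))^2 / qv^2) * (1 - qv ^ (4 * k) / qv)^2 * pochratio k) * ?K
    = gosper_cert qv av ?y * wp_factor av ?y * pochratio m
      + (?K * (?y * (1 - ?y^2 / qv^2) * (1 - ?y / qv)^2)) * pochratio m"
    unfolding sum.lessThan_Suc distrib_right Suc.IH by (simp only: mult_ac)
  also have "\<dots> = gosper_cert qv av (qv^4 * ?y) * wp_factor av (?y / qv^2) * pochratio m"
    unfolding gosper_equation[OF qv_neq_0 av_neq_0, symmetric] by (simp add: algebra_simps)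
  also have "\<dots> = gosper_cert qv av (qv ^ (4 * Suc m)) * wp_factor av (qv ^ (4 * Suc m)) * pochratio (Suc m)"
    using w unfolding pochratio_Suc y by (simp add: mult_ac)
  finally show ?case .
qed

lemma qint_shifted: "x \<noteq> 0 \<Longrightarrow> qint x (4 * int k - 1) = (1 - x ^ (4 * k) / x) / (1 - x)"
proof -
  assume "x \<noteq> 0"
  moreover have "4 * int k = int (4 * k)" by simp
  ultimately show ?thesis unfolding qint_def
    by (simp only: power_int_diff power_int_of_nat power_int_1_right simp_thms)
qed

text \<open>The factor \<open>wp_factor\<close> at q^(4(M+1)) cancels the last factor of each
  shifted factorial in the denominator of H_(M+1). This is why numerators have length
  \<open>Suc M\<close> but denominators only \<open>M\<close>.\<close>

lemma very_well_poised_sum_closed_form: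
  "(\<Sum>k = 0..M. qint (qv ^ 2) (4 * int k - 1) * (qint qv (4 * int k - 1)) ^ 2
       * (qpoch (inverse (qv ^ 2)) (qv ^ 4) k) ^ 2
       * qpoch (inverse (qv ^ 2) / av) (qv ^ 4) k
       * qpoch (av * inverse (qv ^ 2)) (qv ^ 4) k
       / ((qpoch (qv ^ 4) (qv ^ 4) k) ^ 2
          * qpoch (qv ^ 4 / av) (qv ^ 4) k
          * qpoch (av * qv ^ 4) (qv ^ 4) k)
       * qv ^ (4 * k))
   = gosper_cert qv av (qv ^ (4 * Suc M))
     * (qpoch (inverse (qv ^ 2)) (qv ^ 4) (Suc M) / qpoch (qv ^ 4) (qv ^ 4) M) ^ 2
     * qpoch (inverse (qv ^ 2) / av) (qv ^ 4) (Suc M)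
     * qpoch (av * inverse (qv ^ 2)) (qv ^ 4) (Suc M)
     / (qpoch (qv ^ 4 / av) (qv ^ 4) M * qpoch (av * qv ^ 4) (qv ^ 4) M)
     / (qv * (qv^4 - 1) * ((1 - av * qv^2) * (av - qv^2))^2)
     / ((1 - qv^2) * (1 - qv)^2)"
  (is "?lhs = gosper_cert qv av ?Y * ?R1 * ?R2 * ?R3 / ?R4 / ?K / ?L")
proof -
  let ?f = "\<lambda>k. qv ^ (4 * k) * (1 - (qv ^ (4 * k))^2 / qv^2) * (1 - qv ^ (4 * k) / qv)^2 * pochratio k"
  have K: "?K \<noteq> 0"
  proof -
    have "qv^4 - 1 = - emb (1 - Qp^4)" "av - qv^2 = emb (Ap - Qp^2)"
      by (simp_all add: qv_def av_def emb_diff emb_power)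
    then show ?thesis using one_minus_Qp_power_neq_0[of 4] one_minus_Ap_Qp_neq_0[of 2] Ap_minus_Qp_neq_0[of 2]
      by (simp add: one_minus_av_qv)
  qed
  have "?lhs = (\<Sum>k<Suc M. ?f k / ?L)"
  proof (rule sum.cong)
    fix k
    have "qint (qv ^ 2) (4 * int k - 1) = (1 - (qv ^ (4 * k))^2 / qv^2) / (1 - qv^2)"
      by (simp add: qint_shifted) (simp add: mult.commute flip: power_mult)
    then show "qint (qv ^ 2) (4 * int k - 1) * (qint qv (4 * int k - 1)) ^ 2
       * (qpoch (inverse (qv ^ 2)) (qv ^ 4) k) ^ 2
       * qpoch (inverse (qv ^ 2) / av) (qv ^ 4) k
       * qpoch (av * inverse (qv ^ 2)) (qv ^ 4) k
       / ((qpoch (qv ^ 4) (qv ^ 4) k) ^ 2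
          * qpoch (qv ^ 4 / av) (qv ^ 4) k
          * qpoch (av * qv ^ 4) (qv ^ 4) k)
       * qv ^ (4 * k) = ?f k / ?L"
      unfolding pochratio_def qint_shifted[OF qv_neq_0] power_divide
      by (simp add: divide_inverse mult_ac)
  qed auto
  also have "\<dots> = (\<Sum>k<Suc M. ?f k) * ?K / ?K / ?L"
    unfolding sum_divide_distrib[symmetric] nonzero_mult_div_cancel_right[OF K] ..
  also have "\<dots> = gosper_cert qv av ?Y * (wp_factor av ?Y * pochratio (Suc M)) / ?K / ?L"
    unfolding summand_sum by (simp only: mult.assoc)
  also have "wp_factor av ?Y * pochratio (Suc M) = ?R1 * ?R2 * ?R3 / ?R4"
  proof -
    have Y: "qv ^ 4 * (qv ^ 4) ^ M = ?Y"
      by (simp add: power_mult power_add)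
    have *: "1 - ?Y \<noteq> 0" "1 - ?Y / av \<noteq> 0" "1 - av * ?Y \<noteq> 0"
      using wp_factor_neq_0[of "4 * Suc M"] by (simp_all add: wp_factor_def del: power_Suc mult_Suc_right)
    have "qpoch (qv^4) (qv^4) (Suc M) = qpoch (qv^4) (qv^4) M * (1 - ?Y)"
      "qpoch (qv^4 / av) (qv^4) (Suc M) = qpoch (qv^4 / av) (qv^4) M * (1 - ?Y / av)"
      "qpoch (av * qv^4) (qv^4) (Suc M) = qpoch (av * qv^4) (qv^4) M * (1 - av * ?Y)"
      unfolding qpoch_Suc Y[symmetric] by (simp_all add: mult_ac)
    moreover have "(u ^ 2 * v * w) * (P ^ 2 * R * S / ((p * u) ^ 2 * (r * v) * (s * w)))
        = (P / p) ^ 2 * R * S / (r * s)"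
      if "u \<noteq> 0" "v \<noteq> 0" "w \<noteq> 0" for u v w p r s P R S :: ratfun
      using that by (simp add: power_divide power_mult_distrib)
    ultimately show ?thesis using * unfolding pochratio_def wp_factor_def by presburger
  qed
  finally show ?thesis by (simp only: mult.assoc times_divide_eq_right)
qed

section \<open>Divisibility of the closed form by the modulus\<close>

lemma is_unit_of_nat_bipoly: "n > 0 \<Longrightarrow> is_unit (of_nat n :: bipoly)"
  by (simp add: of_nat_poly is_unit_const_poly_iff dvd_field_iff)

text \<open>\<open>qint_sq_poly n\<close> is a nonzero polynomial free of a, while each of the other
  three has a coefficient 1 in a.\<close>

lemma coprime_qint_sq_poly_linear:
  assumes "n > 0"
  shows "coprime (1 - Ap * Qp ^ m) (qint_sq_poly n)" "coprime (Ap - Qp ^ m) (qint_sq_poly n)"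
    "coprime Ap (qint_sq_poly n)"
proof -
  have "qint_sq_poly n = [:\<Sum>j<n. monom 1 (2 * j):]"
    unfolding qint_sq_poly_def Qp_power by (induction n) simp_all
  moreover have "coeff (\<Sum>j<n. monom 1 (2 * j)) 0 = (1::rat)"
    using assms by (simp add: coeff_sum sum.delta' if_distrib cong: if_cong)
  then have "(\<Sum>j<n. monom 1 (2 * j)) \<noteq> (0::rat poly)" by auto
  ultimately have "coeff p i = 1 \<Longrightarrow> coprime p (qint_sq_poly n)" for p i
    using coprime_const_monicI by (metis coprime_commute)
  from this[of _ 0] this[of _ 1] show "coprime (1 - Ap * Qp ^ m) (qint_sq_poly n)"
    "coprime (Ap - Qp ^ m) (qint_sq_poly n)" "coprime Ap (qint_sq_poly n)"
    by (simp_all add: one_minus_Ap_Qp Ap_minus_Qp) (simp add: Ap_def)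
qed

theorem theorem4:
  fixes n M :: nat
  assumes "odd n" and "n > 1"
    and "M = (n + 1) div 2 \<or> M = n - 1"
  shows "rf_cong
    (\<Sum>k = 0..M. qint (qv ^ 2) (4 * int k - 1) * (qint qv (4 * int k - 1)) ^ 2
       * (qpoch (inverse (qv ^ 2)) (qv ^ 4) k) ^ 2
       * qpoch (inverse (qv ^ 2) / av) (qv ^ 4) k
       * qpoch (av * inverse (qv ^ 2)) (qv ^ 4) k
       / ((qpoch (qv ^ 4) (qv ^ 4) k) ^ 2
          * qpoch (qv ^ 4 / av) (qv ^ 4) k
          * qpoch (av * qv ^ 4) (qv ^ 4) k)
       * qv ^ (4 * k))
    0
    ((qint_sq_poly n) ^ 2 * (1 - Ap * Qp ^ (2 * n)) * (Ap - Qp ^ (2 * n)))"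
  (is "rf_cong ?S 0 ?P")
proof -
  let ?L = "localized ?P" and ?G = "qint_sq_poly n"
  have G: "?G = (\<Sum>j<n. (Qp ^ 2) ^ j)" by (simp add: qint_sq_poly_def power_mult)
  have copI: "coprime D ?P"
    if "coprime D ?G" "coprime D (1 - Ap * Qp ^ (2 * n))" "coprime D (Ap - Qp ^ (2 * n))" for D
    using that by simp
  have n0: "n > 0" using assms(2) by simp
  have cop_lin: "coprime [:f:] (1 - Ap * Qp ^ (2 * n))" "coprime [:f:] (Ap - Qp ^ (2 * n))"
    if "f \<noteq> 0" for f
    using coprime_const_monicI[OF that, of _ 0] coprime_const_monicI[OF that, of _ 1]
    by (simp_all add: one_minus_Ap_Qp Ap_minus_Qp)
  have const: "1 - Qp ^ m = [:1 - monom 1 m:]" "1 + Qp ^ m = [:1 + monom 1 m:]" for m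
    by (simp_all add: Qp_power one_pCons)
  \<comment> \<open>Rational coefficients make 2 and \<open>n\<close> units, as coprimality of [n]
    to 1 + x^m and to 1 - x requires.\<close>
  have unit: "is_unit (2::bipoly)" "is_unit (of_nat n :: bipoly)"
    using is_unit_of_nat_bipoly[of 2] is_unit_of_nat_bipoly[of n] n0 by simp_all
  \<comment> \<open>The facts \<open>q\<close> to \<open>minus2\<close> collect the elements
    invertible in the localization; every denominator of the closed form is built from them.\<close>
  have q: "inverse (emb (Qp ^ m)) \<in> ?L" for m
  proof (intro localized_inverse_emb copI)
    have "coprime ((Qp ^ 2) ^ m) ?G" unfolding G by (rule coprime_geometric_sum_power[OF n0])
    then show "coprime (Qp ^ m) ?G" by (cases m) simp_all
  qed (use cop_lin[of "monom 1 m"] in \<open>simp_all add: Qp_power\<close>)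
  have a: "inverse (emb Ap) \<in> ?L"
  proof (intro localized_inverse_emb copI coprime_qint_sq_poly_linear(3)[OF n0])
    show "coprime Ap (1 - Ap * Qp ^ (2 * n))"
      by (rule coprimeI) (metis diff_add_cancel dvd_add dvd_mult2)
    have "coprime (Qp ^ (2 * n)) Ap"
      unfolding Qp_power by (rule coprime_const_monicI[of _ _ 1]) (simp_all add: Ap_def)
    then show "coprime Ap (Ap - Qp ^ (2 * n))"
      unfolding coprime_def by (metis dvd_diff minus_diff_eq dvd_minus_iff diff_add_cancel add_diff_cancel_left')
  qed (simp add: Ap_def)
  have linA: "inverse (emb (1 - Ap * Qp ^ (2 * m))) \<in> ?L" if "m \<noteq> n" for m
    using that n0 by (intro localized_inverse_emb copI coprime_qint_sq_poly_linear coprime_Ap_linear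
      one_minus_Ap_Qp_neq_0) auto
  have linB: "inverse (emb (Ap - Qp ^ (2 * m))) \<in> ?L" if "m \<noteq> n" for m
    using that n0 by (intro localized_inverse_emb copI coprime_qint_sq_poly_linear coprime_Ap_linear
      Ap_minus_Qp_neq_0) auto
  have plus: "inverse (emb (1 + (Qp ^ 2) ^ m)) \<in> ?L" for m
  proof (intro localized_inverse_emb copI)
    show "coprime (1 + (Qp ^ 2) ^ m) ?G"
      unfolding G by (rule coprime_one_plus_geometric_sum[OF assms(1) unit(1)])
    have "1 + monom (1::rat) (2 * m) \<noteq> 0"
      using one_plus_Qp_power_neq_0[of "2 * m"] by (simp add: const)
    then show "coprime (1 + (Qp ^ 2) ^ m) (1 - Ap * Qp ^ (2 * n))"
      "coprime (1 + (Qp ^ 2) ^ m) (Ap - Qp ^ (2 * n))"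
      using cop_lin by (simp_all add: const flip: power_mult)
    show "1 + (Qp ^ 2) ^ m \<noteq> 0"
      using one_plus_Qp_power_neq_0[of "2 * m"] by (simp add: power_mult)
  qed
  have minus2: "inverse (emb (1 - Qp ^ 2)) \<in> ?L"
  proof (intro localized_inverse_emb copI)
    show "coprime (1 - Qp ^ 2) ?G"
      unfolding G by (rule coprime_one_minus_geometric_sum[OF unit(2)])
    have "1 - monom (1::rat) 2 \<noteq> 0"
      using one_minus_Qp_power_neq_0[of 2] by (simp add: const)
    then show "coprime (1 - Qp ^ 2) (1 - Ap * Qp ^ (2 * n))"
      "coprime (1 - Qp ^ 2) (Ap - Qp ^ (2 * n))"
      using cop_lin by (simp_all add: const)
    show "1 - Qp ^ 2 \<noteq> 0" using one_minus_Qp_power_neq_0[of 2] by simp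
  qed

  \<comment> \<open>The index with q^(-2) q^(4 j0) = q^(2n), at which the two linear factors of the
    modulus appear. It is at most \<open>M\<close> for both choices of \<open>M\<close>.\<close>
  define j0 where "j0 = (n + 1) div 2"
  have j0: "4 * j0 = 2 * n + 2" "j0 < Suc M" using assms by (auto simp: j0_def elim!: oddE)
  have pow: "(qv ^ 4) ^ j = emb (Qp ^ (4 * j))" for j
    by (simp add: qv_def emb_power power_mult)

  obtain X1 where X1: "qpoch (av * inverse (qv ^ 2)) (qv ^ 4) (Suc M)
      = emb (1 - Ap * Qp ^ (2 * n)) * X1" "X1 \<in> ?L"
  proof
    let ?f = "\<lambda>j. 1 - av * inverse (qv ^ 2) * (qv ^ 4) ^ j"
    have "?f j = emb (Qp ^ 2 - Ap * Qp ^ (4 * j)) * inverse (emb (Qp ^ 2))" for j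
      unfolding pow using qv_neq_0
      by (simp add: qv_def av_def emb_diff emb_mult emb_power field_simps)
    then show "(\<Prod>j\<in>{..<Suc M} - {j0}. ?f j) \<in> ?L"
      by (intro localized_prod) (simp only: localized_mult localized_emb q)
    have "?f j0 = emb (1 - Ap * Qp ^ (2 * n))"
      unfolding pow j0(1) using qv_neq_0
      by (simp add: qv_def av_def emb_diff emb_mult emb_power power_add power2_eq_square field_simps)
    then show "qpoch (av * inverse (qv ^ 2)) (qv ^ 4) (Suc M)
      = emb (1 - Ap * Qp ^ (2 * n)) * (\<Prod>j\<in>{..<Suc M} - {j0}. ?f j)"
      unfolding qpoch_def using prod.remove[of "{..<Suc M}" j0 ?f] j0(2) by simp
  qed
  obtain X2 where X2: "qpoch (inverse (qv ^ 2) / av) (qv ^ 4) (Suc M)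
      = emb (Ap - Qp ^ (2 * n)) * X2" "X2 \<in> ?L"
  proof
    let ?f = "\<lambda>j. 1 - inverse (qv ^ 2) / av * (qv ^ 4) ^ j"
    have "?f j = emb (Qp ^ 2 * Ap - Qp ^ (4 * j)) * (inverse (emb (Qp ^ 2)) * inverse (emb Ap))" for j
      unfolding pow using qv_neq_0 av_neq_0
      by (simp add: qv_def av_def emb_diff emb_mult emb_power field_simps)
    \<comment> \<open>The factor at \<open>j0\<close> is 1 - q^(2n)/a = (a - q^(2n))/a, so the
      cofactor carries an extra 1/a.\<close>
    then show "inverse (emb Ap) * (\<Prod>j\<in>{..<Suc M} - {j0}. ?f j) \<in> ?L"
      by (intro localized_mult a localized_prod) (simp only: localized_mult localized_emb q a)
    have "?f j0 = emb (Ap - Qp ^ (2 * n)) * inverse (emb Ap)"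
      unfolding pow j0(1) using qv_neq_0 av_neq_0
      by (simp add: qv_def av_def emb_diff emb_mult emb_power power_add power2_eq_square field_simps)
    then show "qpoch (inverse (qv ^ 2) / av) (qv ^ 4) (Suc M)
      = emb (Ap - Qp ^ (2 * n)) * (inverse (emb Ap) * (\<Prod>j\<in>{..<Suc M} - {j0}. ?f j))"
      unfolding qpoch_def using prod.remove[of "{..<Suc M}" j0 ?f] j0(2) by (simp add: mult.assoc)
  qed
  \<comment> \<open>The denominators involve q^(2m) with m = 2(j+1) even, so \<open>m\<close>
    differs from the odd \<open>n\<close> and \<open>linA\<close>, \<open>linB\<close>
    apply.\<close>
  have ne: "2 * Suc j \<noteq> n" for j using assms(1) by auto
  have pow4: "qv ^ 4 * (qv ^ 4) ^ j = qv ^ (2 * (2 * Suc j))" for j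
  proof -
    have "qv ^ 4 * (qv ^ 4) ^ j = qv ^ (4 * Suc j)" by (simp only: power_Suc power_mult)
    also have "4 * Suc j = 2 * (2 * Suc j)" by simp
    finally show ?thesis .
  qed
  have X3: "inverse (qpoch (qv ^ 4 / av) (qv ^ 4) M) \<in> ?L"
  proof -
    have "inverse (1 - qv ^ 4 / av * (qv ^ 4) ^ j)
        = emb Ap * inverse (emb (Ap - Qp ^ (2 * (2 * Suc j))))" for j
    proof -
      have "1 - qv ^ 4 / av * (qv ^ 4) ^ j = 1 - qv ^ (2 * (2 * Suc j)) / av"
        unfolding pow4[symmetric] by simp
      then show ?thesis unfolding one_minus_qv_div_av by (simp add: divide_inverse)
    qed
    then show ?thesis unfolding qpoch_def prod_inversef[symmetric] o_def
      by (intro localized_prod) (simp only: localized_mult localized_emb linB[OF ne])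
  qed
  have X4: "inverse (qpoch (av * qv ^ 4) (qv ^ 4) M) \<in> ?L"
  proof -
    have "inverse (1 - av * qv ^ 4 * (qv ^ 4) ^ j)
        = inverse (emb (1 - Ap * Qp ^ (2 * (2 * Suc j))))" for j
      unfolding mult.assoc pow4 one_minus_av_qv ..
    then show ?thesis unfolding qpoch_def prod_inversef[symmetric] o_def
      by (intro localized_prod) (simp only: linA[OF ne])
  qed
  obtain X5 where X5: "qpoch (inverse (qv ^ 2)) (qv ^ 4) (Suc M) / qpoch (qv ^ 4) (qv ^ 4) M
      = emb ?G * X5" "X5 \<in> ?L"
  proof -
    have "(Qp ^ 2) ^ k \<noteq> 1" if "k > 0" for k
      using one_minus_Qp_power_neq_0[of "2 * k"] that by (simp add: power_mult)
    from odd_even_product_quotient[OF assms this] obtain d where d: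
      "(\<Prod>j<M. 1 - (Qp ^ 2) ^ (2 * j + 1)) * (\<Prod>j<M. 1 + (Qp ^ 2) ^ Suc j) ^ 2
       = (\<Prod>j<M. 1 - (Qp ^ 2) ^ (2 * j + 2)) * (?G * d)"
      (is "?o * ?p ^ 2 = ?e * _") unfolding G by blast
    have p: "?p \<noteq> 0" and e: "?e \<noteq> 0"
      using one_plus_Qp_power_neq_0 one_minus_Qp_power_neq_0
      by (simp_all flip: power_mult del: power_Suc)
    have 1: "qpoch (qv ^ 4) (qv ^ 4) M = emb ?e"
      unfolding qpoch_def emb_prod pow4 one_minus_qv_power
      by (simp only: power_mult[symmetric] mult_Suc_right add.commute)
    \<comment> \<open>Splitting off the factor 1 - q^(-2) at index 0 leaves (x;x^2)_M with x =
      q^2.\<close>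
    have "1 - inverse (qv ^ 2) * (qv ^ 4) ^ Suc j = emb (1 - (Qp ^ 2) ^ (2 * j + 1))" for j
      unfolding pow using qv_neq_0
      by (simp add: qv_def emb_diff emb_mult emb_power power_add field_simps flip: power_mult)
    then have 2: "qpoch (inverse (qv ^ 2)) (qv ^ 4) (Suc M) = (1 - inverse (qv ^ 2)) * emb ?o"
      unfolding qpoch_def prod.lessThan_Suc_shift emb_prod by simp
    have "emb ?o * emb ?p ^ 2 = emb ?e * (emb ?G * emb d)"
      using d by (metis emb_mult emb_power)
    then have oe: "emb ?o / emb ?e = emb ?G * emb d * inverse (emb ?p) ^ 2"
      using p e by (simp add: field_simps)
    have q2: "1 - inverse (qv ^ 2) = emb (Qp ^ 2 - 1) * inverse (emb (Qp ^ 2))"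
      using qv_neq_0 by (simp add: qv_def emb_diff emb_power field_simps)
    have eq: "(1 - inverse (qv ^ 2)) * emb ?o / emb ?e
        = emb ?G * (emb (Qp ^ 2 - 1) * inverse (emb (Qp ^ 2)) * emb d * inverse (emb ?p) ^ 2)"
      unfolding times_divide_eq_right[symmetric] oe q2 by (simp only: mult_ac)
    have "inverse (emb ?p) \<in> ?L"
      unfolding emb_prod prod_inversef[symmetric] o_def by (intro localized_prod plus)
    then show thesis
      by (intro that[OF eq[folded 1 2]] localized_mult localized_power localized_emb q)
  qed

  let ?E = "emb (1 - Ap * Qp ^ 2)" and ?F = "emb (Ap - Qp ^ 2)"
  have K: "inverse (qv * (qv^4 - 1) * ((1 - av * qv^2) * (av - qv^2))^2)
      = emb (- 1) * (inverse (emb (Qp ^ 1)) * (inverse (emb (1 - Qp ^ 2)) * inverse (emb (1 + (Qp ^ 2) ^ 1)))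
        * (inverse ?E * inverse ?F)^2)"
  proof -
    have neg: "emb (- 1) = - 1" using emb_diff[of 0 1] by simp
    have "qv^4 - 1 = emb (- 1) * (emb (1 - Qp ^ 2) * emb (1 + (Qp ^ 2) ^ 1))"
      using neg by (simp add: qv_def algebra_simps emb_power emb_add emb_diff flip: power_add)
    moreover note neg
    moreover have "av - qv^2 = ?F" "qv = emb (Qp ^ 1)" by (simp_all add: qv_def av_def emb_diff emb_power)
    ultimately show ?thesis by (simp add: one_minus_av_qv power_mult_distrib power_inverse)
  qed
  \<comment> \<open>Writing 1/(1 - q) as (1 + q)/(1 - q^2) leaves only 1 - q^2 to invert.\<close>
  have L: "inverse ((1 - qv^2) * (1 - qv)^2)
      = inverse (emb (1 - Qp ^ 2)) * (emb (1 + Qp) * inverse (emb (1 - Qp ^ 2)))^2"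
  proof -
    have "1 - Qp \<noteq> 0" "1 + Qp \<noteq> 0"
      using one_minus_Qp_power_neq_0[of 1] one_plus_Qp_power_neq_0[of 1] by simp_all
    moreover have "1 - Qp ^ 2 = (1 - Qp) * (1 + Qp)" by (simp add: power2_eq_square algebra_simps)
    then have "emb (1 - Qp ^ 2) = emb (1 - Qp) * emb (1 + Qp)" by (simp only: emb_mult)
    ultimately have "emb (1 + Qp) * inverse (emb (1 - Qp ^ 2)) = inverse (emb (1 - Qp))"
      by simp
    then show ?thesis using one_minus_qv_power[of 1] by (simp add: one_minus_qv_power power_inverse)
  qed
  define X where "X = gosper_cert qv av (qv ^ (4 * Suc M)) * X5 ^ 2 * X2 * X1
    * (inverse (qpoch (qv ^ 4 / av) (qv ^ 4) M) * inverse (qpoch (av * qv ^ 4) (qv ^ 4) M))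
    * inverse (qv * (qv^4 - 1) * ((1 - av * qv^2) * (av - qv^2))^2)
    * inverse ((1 - qv^2) * (1 - qv)^2)"
  have "?S = emb ?P * X"
    unfolding very_well_poised_sum_closed_form X1(1) X2(1) X5(1) X_def emb_mult emb_power
    by (simp only: divide_inverse power_mult_distrib inverse_mult_distrib mult_ac)
  moreover have "gosper_cert qv av (qv ^ (4 * Suc M)) \<in> ?L"
    using localized_emb[of "gosper_cert Qp Ap (Qp ^ (4 * Suc M))"]
    by (simp only: emb_gosper_cert emb_power qv_def av_def)
  \<comment> \<open>The factors 1 - a q^2 and a - q^2 of Gosper's denominator are the case m = 1 of
    \<open>linA\<close> and \<open>linB\<close>, available since n > 1.\<close>
  then have "X \<in> ?L"
    unfolding X_def K L using linA[of 1] linB[of 1] assms(2)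
    by (intro localized_mult localized_power localized_emb X1(2) X2(2) X5(2) X3 X4 q plus minus2)
      simp_all
  ultimately show ?thesis using rf_cong_0I by simp
qed

end
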